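(* Let $K$ be a finite simplicial complex, let $f:K\rightarrow\mathbb{R}$ be a combinatorial Morse function over $K$, and let $h_f:K\rightarrow\mathbb{Z}_{\geq 0}$ be the normalization of $f$. Then for every $\sigma\in K$, $h_f(\sigma)\leq g(\sigma)$ whenever $g:K\rightarrow\mathbb{Z}_{\geq 0}$ is a combinatorial Morse function equivalent to $f$.
   Context: $K$ is identified with its set of (non-empty) simplices. Write $\sigma\prec\tau$ (or $\tau\succ\sigma$) if $\sigma$ is an immediate face of $\tau$ in $K$, i.e. $\sigma$ is a face of $\tau$ and $\dim(\sigma)=\dim(\tau)-1$. A discrete vector field over $K$ is a map $W:K\rightarrow K\cup\{0\}$ such that (W1) if $W(\sigma)\neq 0$ then $\sigma\prec W(\sigma)$; (W2) if $W(\sigma)=W(\sigma')\neq 0$ then $\sigma=\sigma'$; (W3) $W^2=0$, i.e. if $W(\sigma)\neq 0$ then $W(W(\sigma))=0$. A combinatorial Morse function over $K$ is a map $f:K\rightarrow\mathbb{R}$ such that for every $\sigma\in K$: (M1) $|\{\eta\prec\sigma : f(\eta)\geq f(\sigma)\}|\leq 1$ and (M2) $|\{\tau\succ\sigma : f(\tau)\leq f(\sigma)\}|\leq 1$. Its gradient vector field $V_f$ is the discrete vector field given by $V_f(\sigma)=\tau$ if $\tau\succ\sigma$ and $f(\sigma)\geq f(\tau)$, and $V_f(\sigma)=0$ if there is no such $\tau$. Two combinatorial Morse functions $f,g$ over $K$ are equivalent if $V_f=V_g$ (equivalently, $f(\sigma)<f(\tau)$ if and only if $g(\sigma)<g(\tau)$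 for every $\sigma\prec\tau$). A path of index $k$ relative to a discrete vector field $W$ is a sequence of $k$-simplices $\sigma_0,\ldots,\sigma_r\in W^{-1}(K)$ such that $\sigma_i\neq\sigma_{i+1}$ and $\sigma_{i+1}\prec W(\sigma_i)$ for all $0\leq i\leq r-1$; it is closed if $\sigma_0=\sigma_r$ and non-stationary if $r>0$. $W$ is admissible if it has no non-stationary closed paths; by a theorem of Forman, this holds if and only if $W$ is the gradient vector field of a combinatorial Morse function. For an admissible discrete vector field $W$, let $\lessdot$ be the relation on $K$ obtained as the transitive closure of the following atomic relations: (1) $\sigma\lessdot\tau$ if $\sigma\prec\tau$; and (2) $\sigma\gtrdot\tau$ (i.e. $\tau\lessdot\sigma$) if $\tau=W(\sigma)$. Write $\sigma\mathbin{\dot{\sim}}\tau$ whenever $\sigma\lessdot\tau$ and $\sigma\gtrdot\tau$. The height function $h:K\rightarrow\mathbb{Z}_{\geq 0}$ associated to $W$ is defined by letting $h(\sigma)$ be the maximum $n\in\mathbb{Z}_{\geq 0}$ for which there exists a chain $\sigma=\sigma_n\gtrdot\sigma_{n-1}\gtrdot\cdots\gtrdot\sigma_0$ in $K$ such that $\sigma_i\mathbin{\dot{\sim}}\sigma_{i+1}$ does not hold for any $0\leq i\leq n-1$. The normalization $h_f$ of a combinatorial Morse function $f$ is the height function associated to $V_f$. *)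

theory Defs
  imports Complex_Main
begin

definition abstract_simplicial_complex :: "'a set set \<Rightarrow> bool" where
  "abstract_simplicial_complex K \<longleftrightarrow>
     (\<forall>\<sigma>\<in>K. finite \<sigma> \<and> \<sigma> \<noteq> {} \<and> (\<forall>\<eta>. \<eta> \<subseteq> \<sigma> \<and> \<eta> \<noteq> {} \<longrightarrow> \<eta> \<in> K))"

(* Integer-valued: with truncated subtraction on nat, a vertex would count as
   an immediate face of itself below. *)
definition simplex_dim :: "'a set \<Rightarrow> int" where
  "simplex_dim \<sigma> = int (card \<sigma>) - 1"

definition immediate_face :: "'a set set \<Rightarrow> 'a set \<Rightarrow> 'a set \<Rightarrow> bool" where
  "immediate_face K \<sigma> \<tau> \<longleftrightarrow>
     \<sigma> \<in> K \<and> \<tau> \<in> K \<and> \<sigma> \<subseteq> \<tau> \<and> simplex_dim \<sigma> = simplex_dim \<tau> - 1"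

(* A map W from K to K together with an extra value 0 is a partial map with
   domain contained in K; None plays the role of 0. *)
definition discrete_vector_field :: "'a set set \<Rightarrow> ('a set \<rightharpoonup> 'a set) \<Rightarrow> bool" where
  "discrete_vector_field K W \<longleftrightarrow>
     dom W \<subseteq> K \<and> ran W \<subseteq> K \<and>
     (\<forall>\<sigma> \<tau>. W \<sigma> = Some \<tau> \<longrightarrow> immediate_face K \<sigma> \<tau>) \<and>
     (\<forall>\<sigma> \<sigma>' \<tau>. W \<sigma> = Some \<tau> \<and> W \<sigma>' = Some \<tau> \<longrightarrow> \<sigma> = \<sigma>') \<and>
     (\<forall>\<sigma> \<tau>. W \<sigma> = Some \<tau> \<longrightarrow> W \<tau> = None)"

(* The sequence is s 0, ..., s r; values of s beyond r are irrelevant. *)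
definition vector_field_path ::
    "'a set set \<Rightarrow> ('a set \<rightharpoonup> 'a set) \<Rightarrow> int \<Rightarrow> nat \<Rightarrow> (nat \<Rightarrow> 'a set) \<Rightarrow> bool" where
  "vector_field_path K W k r s \<longleftrightarrow>
     (\<forall>i\<le>r. s i \<in> K \<and> simplex_dim (s i) = k \<and> W (s i) \<noteq> None) \<and>
     (\<forall>i<r. s i \<noteq> s (Suc i) \<and> immediate_face K (s (Suc i)) (the (W (s i))))"

definition admissible :: "'a set set \<Rightarrow> ('a set \<rightharpoonup> 'a set) \<Rightarrow> bool" where
  "admissible K W \<longleftrightarrow>
     discrete_vector_field K W \<and> \<not> (\<exists>k r s. r > 0 \<and> vector_field_path K W k r s \<and> s 0 = s r)"

definition combinatorial_Morse_function :: "'a set set \<Rightarrow> ('a set \<Rightarrow> real) \<Rightarrow> bool" where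
  "combinatorial_Morse_function K f \<longleftrightarrow>
     (\<forall>\<sigma>\<in>K. card {\<eta>. immediate_face K \<eta> \<sigma> \<and> f \<eta> \<ge> f \<sigma>} \<le> 1 \<and>
            card {\<tau>. immediate_face K \<sigma> \<tau> \<and> f \<tau> \<le> f \<sigma>} \<le> 1)"

definition gradient_vector_field :: "'a set set \<Rightarrow> ('a set \<Rightarrow> real) \<Rightarrow> 'a set \<rightharpoonup> 'a set" where
  "gradient_vector_field K f \<sigma> =
     (if \<exists>\<tau>. immediate_face K \<sigma> \<tau> \<and> f \<sigma> \<ge> f \<tau>
      then Some (THE \<tau>. immediate_face K \<sigma> \<tau> \<and> f \<sigma> \<ge> f \<tau>) else None)"

definition equivalent_Morse :: "'a set set \<Rightarrow> ('a set \<Rightarrow> real) \<Rightarrow> ('a set \<Rightarrow> real) \<Rightarrow> bool" where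
  "equivalent_Morse K f g \<longleftrightarrow> gradient_vector_field K f = gradient_vector_field K g"

definition atomic_below :: "'a set set \<Rightarrow> ('a set \<rightharpoonup> 'a set) \<Rightarrow> 'a set \<Rightarrow> 'a set \<Rightarrow> bool" where
  "atomic_below K W \<sigma> \<tau> \<longleftrightarrow>
     \<sigma> \<in> K \<and> \<tau> \<in> K \<and> (immediate_face K \<sigma> \<tau> \<or> W \<tau> = Some \<sigma>)"

definition below :: "'a set set \<Rightarrow> ('a set \<rightharpoonup> 'a set) \<Rightarrow> 'a set \<Rightarrow> 'a set \<Rightarrow> bool" where
  "below K W = (atomic_below K W)\<^sup>+\<^sup>+"

definition below_sim :: "'a set set \<Rightarrow> ('a set \<rightharpoonup> 'a set) \<Rightarrow> 'a set \<Rightarrow> 'a set \<Rightarrow> bool" where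
  "below_sim K W \<sigma> \<tau> \<longleftrightarrow> below K W \<sigma> \<tau> \<and> below K W \<tau> \<sigma>"

definition descending_chain ::
    "'a set set \<Rightarrow> ('a set \<rightharpoonup> 'a set) \<Rightarrow> 'a set \<Rightarrow> nat \<Rightarrow> (nat \<Rightarrow> 'a set) \<Rightarrow> bool" where
  "descending_chain K W \<sigma> n c \<longleftrightarrow>
     c n = \<sigma> \<and> (\<forall>i\<le>n. c i \<in> K) \<and>
     (\<forall>i<n. below K W (c i) (c (Suc i)) \<and> \<not> below_sim K W (c i) (c (Suc i)))"

(* The maximum is over a finite non-empty set by finite_chain_lengths and
   chain_lengths_nonempty. *)
definition height_function :: "'a set set \<Rightarrow> ('a set \<rightharpoonup> 'a set) \<Rightarrow> 'a set \<Rightarrow> nat" where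
  "height_function K W \<sigma> = Max {n. \<exists>c. descending_chain K W \<sigma> n c}"

definition normalization :: "'a set set \<Rightarrow> ('a set \<Rightarrow> real) \<Rightarrow> 'a set \<Rightarrow> nat" where
  "normalization K f = height_function K (gradient_vector_field K f)"

lemma chain_lengths_nonempty:
  assumes "\<sigma> \<in> K"
  shows "0 \<in> {n. \<exists>c. descending_chain K W \<sigma> n c}"
  using assms by (auto simp: descending_chain_def intro!: exI[of _ "\<lambda>_. \<sigma>"])

lemma finite_chain_lengths:
  assumes "finite K"
  shows "finite {n. \<exists>c. descending_chain K W \<sigma> n c}"
proof -
  have "n \<le> card K" if ch: "descending_chain K W \<sigma> n c" for n c
  proof -
    have tr: "below K W x z" if "below K W x y" "below K W y z" for x y z
      using that unfolding below_def by (rule tranclp_trans)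
    have st: "below K W (c i) (c j) \<and> \<not> below K W (c j) (c i)" if "i < j" "j \<le> n" for i j
      using that
    proof (induction j)
      case (Suc j)
      have s: "below K W (c j) (c (Suc j))" "\<not> below K W (c (Suc j)) (c j)"
        using ch Suc.prems by (auto simp: descending_chain_def below_sim_def)
      show ?case
      proof (cases "i = j")
        case False
        with Suc have "below K W (c i) (c j)" by auto
        with s show ?thesis using tr by blast
      qed (use s in simp)
    qed simp
    have "inj_on c {..n}"
    proof (rule linorder_inj_onI')
      fix i j assume "i \<in> {..n}" "j \<in> {..n}" "i < j"
      with st[of i j] show "c i \<noteq> c j" by auto
    qed
    moreover have "c ` {..n} \<subseteq> K" using ch by (auto simp: descending_chain_def)
    ultimately have "card {..n} \<le> card K" using assms by (intro card_inj_on_le)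
    then show ?thesis by simp
  qed
  then have "{n. \<exists>c. descending_chain K W \<sigma> n c} \<subseteq> {..card K}" by auto
  then show ?thesis by (rule finite_subset) simp
qed

lemma gradient_vector_field_eq_Some_iff:
  assumes "finite K" "combinatorial_Morse_function K f"
  shows "gradient_vector_field K f \<sigma> = Some \<tau> \<longleftrightarrow> immediate_face K \<sigma> \<tau> \<and> f \<sigma> \<ge> f \<tau>"
proof -
  let ?P = "\<lambda>\<tau>. immediate_face K \<sigma> \<tau> \<and> f \<sigma> \<ge> f \<tau>"
  have "\<tau>1 = \<tau>2" if "?P \<tau>1" "?P \<tau>2" for \<tau>1 \<tau>2
  proof -
    have "finite {\<tau>. immediate_face K \<sigma> \<tau> \<and> f \<tau> \<le> f \<sigma>}"
      by (rule finite_subset[OF _ assms(1)]) (auto simp: immediate_face_def)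
    moreover have "card {\<tau>. immediate_face K \<sigma> \<tau> \<and> f \<tau> \<le> f \<sigma>} \<le> Suc 0"
      using assms(2) that(1) by (auto simp: combinatorial_Morse_function_def immediate_face_def)
    ultimately show ?thesis using that by (auto simp: card_le_Suc0_iff_eq)
  qed
  then have "(THE \<tau>. ?P \<tau>) = \<tau>" if "?P \<tau>" for \<tau>
    using that by (intro the_equality) auto
  then show ?thesis by (auto simp: gradient_vector_field_def)
qed

lemma immediate_face_below_unique:
  assumes "finite K" "combinatorial_Morse_function K f"
    and "immediate_face K \<eta>1 \<sigma>" "f \<eta>1 \<ge> f \<sigma>" "immediate_face K \<eta>2 \<sigma>" "f \<eta>2 \<ge> f \<sigma>"
  shows "\<eta>1 = \<eta>2"
proof -
  have "finite {\<eta>. immediate_face K \<eta> \<sigma> \<and> f \<eta> \<ge> f \<sigma>}"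
    by (rule finite_subset[OF _ assms(1)]) (auto simp: immediate_face_def)
  moreover have "card {\<eta>. immediate_face K \<eta> \<sigma> \<and> f \<eta> \<ge> f \<sigma>} \<le> Suc 0"
    using assms(2,3) by (auto simp: combinatorial_Morse_function_def immediate_face_def)
  ultimately show ?thesis using assms by (auto simp: card_le_Suc0_iff_eq)
qed

lemma immediate_face_diamond:
  assumes K: "abstract_simplicial_complex K"
    and "immediate_face K \<sigma> \<tau>" "immediate_face K \<tau> \<rho>"
  obtains \<tau>' where "\<tau>' \<noteq> \<tau>" "immediate_face K \<sigma> \<tau>'" "immediate_face K \<tau>' \<rho>"
proof -
  have fin: "finite \<rho>" "finite \<tau>" "finite \<sigma>"
    using assms by (auto simp: abstract_simplicial_complex_def immediate_face_def)
  have ne: "\<sigma> \<noteq> {}" and sub: "\<sigma> \<subseteq> \<tau>" "\<tau> \<subseteq> \<rho>"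
    and c: "card \<tau> = Suc (card \<sigma>)" "card \<rho> = Suc (card \<tau>)"
    using assms by (auto simp: abstract_simplicial_complex_def immediate_face_def simplex_dim_def)
  have "\<not> \<rho> \<subseteq> \<tau>" using card_mono[OF fin(2), of \<rho>] c by auto
  then obtain v where v: "v \<in> \<rho>" "v \<notin> \<tau>" by auto
  let ?t = "insert v \<sigma>"
  have vs: "v \<notin> \<sigma>" using v sub by auto
  have tK: "?t \<in> K" using K assms(3) v sub
    by (auto simp: abstract_simplicial_complex_def immediate_face_def)
  show ?thesis
  proof (rule that[of ?t])
    show "?t \<noteq> \<tau>" using v by auto
    show "immediate_face K \<sigma> ?t" "immediate_face K ?t \<rho>"
      using assms tK vs fin c v sub by (auto simp: immediate_face_def simplex_dim_def)
  qed
qed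

lemma gradient_vector_field_admissible:
  assumes "abstract_simplicial_complex K" "finite K" "combinatorial_Morse_function K f"
  shows "admissible K (gradient_vector_field K f)"
proof -
  note iff = gradient_vector_field_eq_Some_iff[OF assms(2,3)]
  note V_D = iff[THEN iffD1]
  note uniq = immediate_face_below_unique[OF assms(2,3)]
  let ?V = "gradient_vector_field K f"
  have W3: "?V \<tau> = None" if V\<sigma>: "?V \<sigma> = Some \<tau>" for \<sigma> \<tau>
  proof (rule ccontr)
    assume "?V \<tau> \<noteq> None"
    then obtain \<rho> where V\<tau>: "?V \<tau> = Some \<rho>" by blast
    have \<sigma>: "immediate_face K \<sigma> \<tau>" "f \<tau> \<le> f \<sigma>" using V_D[OF V\<sigma>] by auto
    have \<tau>: "immediate_face K \<tau> \<rho>" "f \<rho> \<le> f \<tau>" using V_D[OF V\<tau>] by auto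
    obtain \<tau>' where t: "\<tau>' \<noteq> \<tau>" "immediate_face K \<sigma> \<tau>'" "immediate_face K \<tau>' \<rho>"
      by (rule immediate_face_diamond[OF assms(1) \<sigma>(1) \<tau>(1)])
    have a: "\<not> f \<tau>' \<le> f \<sigma>"
    proof
      assume "f \<tau>' \<le> f \<sigma>"
      with t(2) have "?V \<sigma> = Some \<tau>'" by (simp add: iff)
      with V\<sigma> t(1) show False by simp
    qed
    have b: "\<not> f \<rho> \<le> f \<tau>'" using uniq[OF \<tau> t(3)] t(1) by auto
    show False using a b \<sigma>(2) \<tau>(2) by linarith
  qed
  have dvf: "discrete_vector_field K ?V"
    unfolding discrete_vector_field_def
  proof (intro conjI allI impI)
    show "dom ?V \<subseteq> K" "ran ?V \<subseteq> K"
      by (auto simp: dom_def ran_def immediate_face_def dest: V_D)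
    show "immediate_face K \<sigma> \<tau>" if "?V \<sigma> = Some \<tau>" for \<sigma> \<tau>
      using V_D[OF that] by simp
    show "\<sigma> = \<sigma>'" if "?V \<sigma> = Some \<tau> \<and> ?V \<sigma>' = Some \<tau>" for \<sigma> \<sigma>' \<tau>
    proof (rule uniq)
      show "immediate_face K \<sigma> \<tau>" "f \<tau> \<le> f \<sigma>" "immediate_face K \<sigma>' \<tau>" "f \<tau> \<le> f \<sigma>'"
        using V_D[OF conjunct1[OF that]] V_D[OF conjunct2[OF that]] by simp_all
    qed
    show "?V \<tau> = None" if "?V \<sigma> = Some \<tau>" for \<sigma> \<tau>
      using that by (rule W3)
  qed
  have "False" if r: "r > 0" and p: "vector_field_path K ?V k r s" and cl: "s 0 = s r" for k r s
  proof -
    have step: "f (s (Suc i)) < f (s i)" if "i < r" for i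
    proof -
      have "?V (s i) \<noteq> None"
        using p that unfolding vector_field_path_def by (meson less_imp_le)
      then obtain \<tau> where t: "?V (s i) = Some \<tau>" by blast
      then have t': "immediate_face K (s i) \<tau>" "f \<tau> \<le> f (s i)" using V_D[OF t] by auto
      have "s i \<noteq> s (Suc i) \<and> immediate_face K (s (Suc i)) (the (?V (s i)))"
        using p that unfolding vector_field_path_def by blast
      then have n: "s i \<noteq> s (Suc i)" "immediate_face K (s (Suc i)) \<tau>"
        by (simp_all add: t)
      have "f (s (Suc i)) < f \<tau>" using uniq[OF t' n(2)] n(1) by (meson not_le)
      then show ?thesis using t'(2) by linarith
    qed
    have "j \<le> r \<Longrightarrow> j > 0 \<Longrightarrow> f (s j) < f (s 0)" for j
    proof (induction j)
      case (Suc j)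
      have "f (s (Suc j)) < f (s j)" using step[of j] Suc.prems by simp
      moreover have "j = 0 \<or> f (s j) < f (s 0)" using Suc by auto
      ultimately show ?case by auto
    qed simp
    from this[of r] r cl show False by simp
  qed
  with dvf show ?thesis unfolding admissible_def by blast
qed

end

theory Submission imports Defs begin

text \<open>
  Write \<open>V\<close> for the common gradient vector field. A chain counted by the height function need not be
  strictly monotone in \<open>g\<close>: since \<open>\<sigma>\<close> and \<open>V \<sigma>\<close> lie in one \<open>below_sim\<close> class although \<open>g \<sigma>\<close> may
  exceed \<open>g (V \<sigma>)\<close>, an element strictly above that class can have a value smaller than \<open>g \<sigma>\<close>.
  The remedy is to evaluate \<open>g\<close> at the upper end of each matched pair, where it takes its smaller
  value: with \<open>u \<sigma> = V \<sigma>\<close> if \<open>\<sigma>\<close> is matched with a coface and \<open>u \<sigma> = \<sigma>\<close> otherwise, the function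
  \<open>g \<circ> u\<close> is at most \<open>g\<close>, and it increases strictly along every atomic relation except those
  inside a matched pair, on which it is constant (\<open>upper_end_atomic_below\<close>). The one case that
  needs the simplicial structure is \<open>\<eta> \<prec> \<sigma>\<close> with \<open>V \<sigma> = \<tau>\<close>: going from \<open>\<eta>\<close> to \<open>\<tau>\<close> through the
  other intermediate simplex gives \<open>g (u \<eta>) < g \<tau>\<close> (\<open>upper_end_immediate_face\<close>). Hence \<open>g \<circ> u\<close>
  increases strictly along strict steps of \<open>below\<close>. As its values are natural numbers, a descending
  chain of length \<open>n\<close> from \<open>\<sigma>\<close> forces \<open>n \<le> g (u \<sigma>) \<le> g \<sigma>\<close>.
\<close>

text \<open>The upper end of the pair containing \<open>\<sigma>\<close>: the image \<open>W \<sigma>\<close> if there is one, and \<open>\<sigma>\<close> itself if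
  \<open>\<sigma>\<close> is critical or already an image of \<open>W\<close>.\<close>

definition upper_end :: "('a set \<rightharpoonup> 'a set) \<Rightarrow> 'a set \<Rightarrow> 'a set" where
  "upper_end W \<sigma> = (case W \<sigma> of None \<Rightarrow> \<sigma> | Some \<tau> \<Rightarrow> \<tau>)"

lemma upper_end_le:
  assumes "finite K" "combinatorial_Morse_function K f"
  shows "f (upper_end (gradient_vector_field K f) \<sigma>) \<le> f \<sigma>"
  using gradient_vector_field_eq_Some_iff[OF assms, of \<sigma>]
  by (auto simp: upper_end_def split: option.split)

lemma upper_end_eq_pair:
  assumes "discrete_vector_field K W" "W \<sigma> = Some \<tau>"
  shows "upper_end W \<sigma> = upper_end W \<tau>"
proof -
  have "W \<tau> = None" using assms unfolding discrete_vector_field_def by blast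
  with assms(2) show ?thesis by (simp add: upper_end_def)
qed

lemma upper_end_immediate_face:
  assumes K: "abstract_simplicial_complex K" "finite K" and f: "combinatorial_Morse_function K f"
    and face: "immediate_face K \<eta> \<sigma>" and unmatched: "gradient_vector_field K f \<eta> \<noteq> Some \<sigma>"
  shows "f (upper_end (gradient_vector_field K f) \<eta>)
       < f (upper_end (gradient_vector_field K f) \<sigma>)"
proof -
  let ?V = "gradient_vector_field K f"
  note V_iff = gradient_vector_field_eq_Some_iff[OF K(2) f]
  note le = upper_end_le[OF K(2) f]
  show ?thesis
  proof (cases "?V \<sigma>")
    case None
    have "f \<eta> < f \<sigma>" using face unmatched by (simp add: V_iff)
    with le[of \<eta>] None show ?thesis by (simp add: upper_end_def)
  next
    case (Some \<tau>)
    then have \<tau>: "immediate_face K \<sigma> \<tau>" "f \<tau> \<le> f \<sigma>" by (simp_all add: V_iff)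
    obtain \<sigma>' where \<sigma>': "\<sigma>' \<noteq> \<sigma>" "immediate_face K \<eta> \<sigma>'" "immediate_face K \<sigma>' \<tau>"
      by (rule immediate_face_diamond[OF K(1) face \<tau>(1)])
    have less: "f \<sigma>' < f \<tau>"
      using immediate_face_below_unique[OF K(2) f \<tau> \<sigma>'(3)] \<sigma>'(1) by force
    have "f (upper_end ?V \<eta>) \<le> f \<sigma>'"
    proof (cases "?V \<eta> = Some \<sigma>'")
      case True
      then show ?thesis by (simp add: upper_end_def)
    next
      case False
      then have "f \<eta> < f \<sigma>'" using \<sigma>'(2) by (simp add: V_iff)
      with le[of \<eta>] show ?thesis by simp
    qed
    with less Some show ?thesis by (simp add: upper_end_def)
  qed
qed

lemma upper_end_atomic_below:
  assumes K: "abstract_simplicial_complex K" "finite K" and f: "combinatorial_Morse_function K f"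
    and at: "atomic_below K (gradient_vector_field K f) \<sigma> \<tau>"
  defines "m \<equiv> \<lambda>\<rho>. f (upper_end (gradient_vector_field K f) \<rho>)"
  shows "m \<sigma> < m \<tau> \<or> m \<sigma> = m \<tau> \<and> atomic_below K (gradient_vector_field K f) \<tau> \<sigma>"
proof -
  let ?V = "gradient_vector_field K f"
  have dvf: "discrete_vector_field K ?V"
    using gradient_vector_field_admissible[OF K f] by (simp add: admissible_def)
  have mem: "\<sigma> \<in> K" "\<tau> \<in> K" using at by (auto simp: atomic_below_def)
  consider "?V \<tau> = Some \<sigma>" | "?V \<sigma> = Some \<tau>" | "immediate_face K \<sigma> \<tau>" "?V \<sigma> \<noteq> Some \<tau>"
    using at by (auto simp: atomic_below_def)
  then show ?thesis
  proof cases
    case 1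
    then have "immediate_face K \<tau> \<sigma>" using dvf unfolding discrete_vector_field_def by blast
    with mem show ?thesis
      using upper_end_eq_pair[OF dvf 1] by (simp add: m_def atomic_below_def)
  next
    case 2
    with mem show ?thesis
      using upper_end_eq_pair[OF dvf 2] by (simp add: m_def atomic_below_def)
  next
    case 3
    then show ?thesis using upper_end_immediate_face[OF K f] by (simp add: m_def)
  qed
qed

lemma upper_end_below_strict:
  assumes K: "abstract_simplicial_complex K" "finite K" and f: "combinatorial_Morse_function K f"
    and bel: "below K (gradient_vector_field K f) \<sigma> \<tau>"
    and strict: "\<not> below_sim K (gradient_vector_field K f) \<sigma> \<tau>"
  shows "f (upper_end (gradient_vector_field K f) \<sigma>)
       < f (upper_end (gradient_vector_field K f) \<tau>)"
proof -
  let ?A = "atomic_below K (gradient_vector_field K f)"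
  define m where "m = (\<lambda>\<rho>. f (upper_end (gradient_vector_field K f) \<rho>))"
  have atomic: "m \<rho> < m \<rho>' \<or> m \<rho> = m \<rho>' \<and> ?A \<rho>' \<rho>" if "?A \<rho> \<rho>'" for \<rho> \<rho>'
    using upper_end_atomic_below[OF K f that] by (simp add: m_def)
  have "?A\<^sup>+\<^sup>+ \<sigma> \<tau>" using bel by (simp add: below_def)
  then have "m \<sigma> < m \<tau> \<or> m \<sigma> = m \<tau> \<and> ?A\<^sup>+\<^sup>+ \<tau> \<sigma>"
  proof (induction rule: tranclp_induct)
    case (base \<rho>)
    then show ?case using atomic by blast
  next
    case (step \<rho> \<rho>')
    from atomic[OF step.hyps(2)] step.IH show ?case by (auto intro: tranclp_into_tranclp2)
  qed
  then show ?thesis using bel strict by (auto simp: m_def below_sim_def below_def)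
qed

lemma descending_chain_length_le:
  fixes m :: "'a set \<Rightarrow> nat"
  assumes chain: "descending_chain K W \<sigma> n c"
    and strict: "\<And>\<rho> \<tau>. below K W \<rho> \<tau> \<Longrightarrow> \<not> below_sim K W \<rho> \<tau> \<Longrightarrow> m \<rho> < m \<tau>"
  shows "n \<le> m \<sigma>"
proof -
  have "i \<le> m (c i)" if "i \<le> n" for i
    using that
  proof (induction i)
    case (Suc i)
    have "m (c i) < m (c (Suc i))"
      using chain Suc.prems by (intro strict) (auto simp: descending_chain_def)
    with Suc show ?case by simp
  qed simp
  from this[of n] chain show ?thesis by (simp add: descending_chain_def)
qed

theorem proposition5:
  fixes K :: "'a set set" and f :: "'a set \<Rightarrow> real" and g :: "'a set \<Rightarrow> nat" and \<sigma> :: "'a set"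
  assumes "abstract_simplicial_complex K"
    and "finite K"
    and "combinatorial_Morse_function K f"
    and "\<sigma> \<in> K"
    and "combinatorial_Morse_function K (\<lambda>\<tau>. real (g \<tau>))"
    and "equivalent_Morse K f (\<lambda>\<tau>. real (g \<tau>))"
  shows "normalization K f \<sigma> \<le> g \<sigma>"
proof -
  define V where "V = gradient_vector_field K (\<lambda>\<tau>. real (g \<tau>))"
  let ?N = "{n. \<exists>c. descending_chain K V \<sigma> n c}"
  have strict: "g (upper_end V \<rho>) < g (upper_end V \<tau>)"
    if "below K V \<rho> \<tau>" "\<not> below_sim K V \<rho> \<tau>" for \<rho> \<tau>
    using upper_end_below_strict[OF assms(1,2,5)] that unfolding V_def by simp
  have le: "g (upper_end V \<sigma>) \<le> g \<sigma>"
    using upper_end_le[OF assms(2,5), of \<sigma>] unfolding V_def by simp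
  have "n \<le> g \<sigma>" if "n \<in> ?N" for n
  proof -
    from that obtain c where "descending_chain K V \<sigma> n c" by blast
    from descending_chain_length_le[OF this, of "\<lambda>\<rho>. g (upper_end V \<rho>)"] strict le
    show ?thesis by fastforce
  qed
  moreover have "finite ?N" using assms(2) by (rule finite_chain_lengths)
  moreover have "?N \<noteq> {}" using chain_lengths_nonempty[OF assms(4)] by blast
  ultimately have "Max ?N \<le> g \<sigma>" by simp
  moreover have "gradient_vector_field K f = V"
    using assms(6) by (simp add: equivalent_Morse_def V_def)
  ultimately show ?thesis by (simp add: normalization_def height_function_def)
qed

end
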